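(* Let $L=(T_1,\dots,T_m)$ be any list of $m:=\mathrm{poly}(n)$ disjunctions (ORs of subsets of the input variables) on $n$-bit inputs, and let $\mu$ be any $\mathrm{poly}(n)$ time samplable distribution over $\{0,1\}^m$. Let $\mu^{\land\lor}_L$ be the distribution obtained by sampling $\theta\sim\mu$ and outputting the conjunction of all disjunctions $T_i\in L$ with $\theta_i=1$ (the paper calls these formulas DNFs). Then the pair $(\mathrm{DNF},\mu^{\land\lor}_L)$ is efficiently distributionally PAC-learnable.
   Context: $(\mathrm{DNF},\mu^{\land\lor}_L)$ is efficiently distributionally PAC-learnable if there is an algorithm $A$ running in time $\mathrm{poly}(n,\epsilon^{-1},\delta^{-1},\eta^{-1})$ such that for all $n,\epsilon,\delta,\eta>0$: $\Pr_{f\sim\mu^{\land\lor}_L}[\Pr_A[\forall\rho: \Pr_{x\sim\rho}[h(x)\ne f(x)]\le\epsilon,\ h\leftarrow A^{\mathrm{EX}(f,\rho)}(n,\epsilon,\delta,\eta)]\ge1-\delta]\ge1-\eta$, where $\rho$ ranges over all distributions on $\{0,1\}^n$ and $\mathrm{EX}(f,\rho)$ returns independent labelled examples $\langle x,f(x)\rangle$, $x\sim\rho$. *)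

theory Defs
  imports "HOL-Probability.Probability"
begin

section \<open>Machine model\<close>

text \<open>
  Probabilistic oracle machines with finitely many binary stacks, written as structured programs.
  A configuration is a list of pending commands together with the contents of the stacks.  Every
  transition does a constant amount of work on the stacks (as on a multitape Turing machine)
  and costs one time unit; as usual for oracle machines, so does an oracle call.
  \<open>Query r\<close> replaces the contents of stack \<open>r\<close> by a fresh sample of the oracle
  distribution, \<open>Flip r\<close> pushes a fair coin flip.
\<close>

datatype test =
    Nonempty nat
  | Top nat

datatype cmd =
    Push nat bool
  | Pop nat
  | Flip nat
  | Query nat
  | Cond test "cmd list" "cmd list"
  | Loop test "cmd list"

type_synonym stacks = "nat \<Rightarrow> bool list"

type_synonym config = "cmd list \<times> stacks"

fun holds :: "test \<Rightarrow> stacks \<Rightarrow> bool" where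
  "holds (Nonempty r) s \<longleftrightarrow> s r \<noteq> []"
| "holds (Top r) s \<longleftrightarrow> s r \<noteq> [] \<and> hd (s r)"

fun step :: "bool list pmf \<Rightarrow> config \<Rightarrow> config pmf" where
  "step orc ([], s) = return_pmf ([], s)"
| "step orc (Push r b # cs, s) = return_pmf (cs, s(r := b # s r))"
| "step orc (Pop r # cs, s) = return_pmf (cs, s(r := tl (s r)))"
| "step orc (Flip r # cs, s) = map_pmf (\<lambda>b. (cs, s(r := b # s r))) (bernoulli_pmf (1/2))"
| "step orc (Query r # cs, s) = map_pmf (\<lambda>w. (cs, s(r := w))) orc"
| "step orc (Cond t ps qs # cs, s) = return_pmf ((if holds t s then ps else qs) @ cs, s)"
| "step orc (Loop t ps # cs, s) = return_pmf (if holds t s then ps @ Loop t ps # cs else cs, s)"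

fun steps :: "bool list pmf \<Rightarrow> nat \<Rightarrow> config \<Rightarrow> config pmf" where
  "steps orc 0 c = return_pmf c"
| "steps orc (Suc t) c = bind_pmf (step orc c) (steps orc t)"

text \<open>The \<open>i\<close>-th input word is initially on stack \<open>i\<close>, its first bit on top.\<close>

definition initial :: "cmd list \<Rightarrow> bool list list \<Rightarrow> config" where
  "initial P ws = (P, \<lambda>r. if r < length ws then ws ! r else [])"

definition halts_within :: "bool list pmf \<Rightarrow> cmd list \<Rightarrow> bool list list \<Rightarrow> nat \<Rightarrow> bool" where
  "halts_within orc P ws t \<longleftrightarrow> (\<forall>c \<in> set_pmf (steps orc t (initial P ws)). fst c = [])"

text \<open>
  The output is read off stack 0.  Halted configurations do not change any more, so for a
  machine that halts within \<open>t\<close> steps this is the distribution of its final output.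
\<close>

definition final_output :: "bool list pmf \<Rightarrow> cmd list \<Rightarrow> bool list list \<Rightarrow> nat \<Rightarrow> bool list pmf" where
  "final_output orc P ws t = map_pmf (\<lambda>c. snd c 0) (steps orc t (initial P ws))"

lemma steps_halted: "steps orc t ([], s) = return_pmf ([], s)"
  by (induction t) (simp_all add: bind_return_pmf)

text \<open>For machines without an oracle, a query just yields the empty word.\<close>

abbreviation no_oracle :: "bool list pmf" where
  "no_oracle \<equiv> return_pmf []"

definition unary :: "nat \<Rightarrow> bool list" where
  "unary k = replicate k True"


section \<open>Polynomial time\<close>

definition poly_bounded :: "(nat \<Rightarrow> nat) \<Rightarrow> bool" where
  "poly_bounded m \<longleftrightarrow> (\<exists>c k. \<forall>n>0. m n \<le> c * n ^ k)"

text \<open>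
  A family of distributions is samplable in polynomial time if some oracle-free probabilistic
  machine, given \<open>n\<close> in unary and the description \<open>desc n\<close> of the problem at length \<open>n\<close>,
  outputs a sample of \<open>\<mu> n\<close> in time polynomial in \<open>n\<close>.
\<close>

definition poly_time_samplable :: "(nat \<Rightarrow> bool list) \<Rightarrow> (nat \<Rightarrow> bool list pmf) \<Rightarrow> bool" where
  "poly_time_samplable desc \<mu> \<longleftrightarrow> (\<exists>S c k. \<forall>n>0.
     halts_within no_oracle S [unary n, desc n] (c * n ^ k) \<and>
     final_output no_oracle S [unary n, desc n] (c * n ^ k) = \<mu> n)"

text \<open>
  \<open>h w\<close> is the hypothesis represented by the word \<open>w\<close>; as usual in PAC learning, hypotheses
  must be evaluable in time polynomial in the sizes of the representation and of the argument.
\<close>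

definition poly_time_evaluable :: "(bool list \<Rightarrow> bool list \<Rightarrow> bool) \<Rightarrow> bool" where
  "poly_time_evaluable h \<longleftrightarrow> (\<exists>E c k. \<forall>w x.
     (let t = c * (length w + length x + 1) ^ k in
        halts_within no_oracle E [w, x] t \<and>
        final_output no_oracle E [w, x] t = return_pmf [h w x]))"


section \<open>Distributional PAC learning\<close>

definition cube :: "nat \<Rightarrow> bool list set" where
  "cube n = {x. length x = n}"

definition example_oracle :: "(bool list \<Rightarrow> bool) \<Rightarrow> bool list pmf \<Rightarrow> bool list pmf" where
  "example_oracle f \<rho> = map_pmf (\<lambda>x. x @ [f x]) \<rho>"

text \<open>
  The real parameters are handed to the learner as \<open>\<lceil>1/\<epsilon>\<rceil>\<close>, \<open>\<lceil>1/\<delta>\<rceil>\<close>, \<open>\<lceil>1/\<eta>\<rceil>\<close> in unary.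
  In addition it sees a description of the problem at length \<open>n\<close>: the list of disjunctions
  below is an arbitrary, possibly non-computable, function of \<open>n\<close>, so a uniform
  learner has to be told the list.  It gets no other advice.
\<close>

definition learner_input :: "nat \<Rightarrow> real \<Rightarrow> real \<Rightarrow> real \<Rightarrow> bool list \<Rightarrow> bool list list" where
  "learner_input n \<epsilon> \<delta> \<eta> d =
     [unary n, unary (nat \<lceil>1/\<epsilon>\<rceil>), unary (nat \<lceil>1/\<delta>\<rceil>), unary (nat \<lceil>1/\<eta>\<rceil>), d]"

definition learner_time :: "nat \<Rightarrow> nat \<Rightarrow> nat \<Rightarrow> real \<Rightarrow> real \<Rightarrow> real \<Rightarrow> nat" where
  "learner_time c k n \<epsilon> \<delta> \<eta> = nat \<lfloor>real c * (real n + 1/\<epsilon> + 1/\<delta> + 1/\<eta>) ^ k\<rfloor>"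

text \<open>
  \<open>C n\<close> is a class of formulas with semantics \<open>sem\<close>, and \<open>\<mu> n\<close> a distribution on \<open>C n\<close>.
  The inner probability is over the coins of the learner and the examples it draws, so
  the example distribution \<open>\<rho>\<close> is fixed before it (but after the target \<open>F\<close>).
  The running time bound is worst case, for every target function.
\<close>

definition efficiently_dist_PAC_learnable ::
  "(nat \<Rightarrow> 'r set) \<Rightarrow> ('r \<Rightarrow> bool list \<Rightarrow> bool) \<Rightarrow> (nat \<Rightarrow> 'r pmf) \<Rightarrow> (nat \<Rightarrow> bool list) \<Rightarrow> bool"
where
  "efficiently_dist_PAC_learnable C sem \<mu> desc \<longleftrightarrow>
     (\<forall>n>0. set_pmf (\<mu> n) \<subseteq> C n) \<and>
     (\<exists>A h c k. poly_time_evaluable h \<and>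
       (\<forall>n>0. \<forall>\<epsilon>>0. \<forall>\<delta>>0. \<forall>\<eta>>0.
          (let inp = learner_input n \<epsilon> \<delta> \<eta> (desc n); t = learner_time c k n \<epsilon> \<delta> \<eta> in
             (\<forall>f \<rho>. set_pmf \<rho> \<subseteq> cube n \<longrightarrow> halts_within (example_oracle f \<rho>) A inp t) \<and>
             measure_pmf.prob (\<mu> n)
               {F. \<forall>\<rho>. set_pmf \<rho> \<subseteq> cube n \<longrightarrow>
                     measure_pmf.prob (final_output (example_oracle (sem F) \<rho>) A inp t)
                       {w. measure_pmf.prob \<rho> {x. h w x \<noteq> sem F x} \<le> \<epsilon>} \<ge> 1 - \<delta>}
             \<ge> 1 - \<eta>)))"


section \<open>Random conjunctions of disjunctions from a list\<close>

text \<open>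
  A disjunction is given by its set of variables, a formula is the conjunction of a list
  of disjunctions.  Such formulas are called DNFs here, although they are
  conjunctions of disjunctions.
\<close>

type_synonym formula = "nat set list"

definition eval_formula :: "formula \<Rightarrow> bool list \<Rightarrow> bool" where
  "eval_formula F x \<longleftrightarrow> (\<forall>T \<in> set F. \<exists>i \<in> T. x ! i)"

definition DNF :: "nat \<Rightarrow> formula set" where
  "DNF n = {F. \<forall>T \<in> set F. T \<subseteq> {..<n}}"

definition select :: "nat set list \<Rightarrow> bool list \<Rightarrow> formula" where
  "select L \<theta> = map snd (filter fst (zip \<theta> L))"

definition mu_and_or :: "(nat \<Rightarrow> nat set list) \<Rightarrow> (nat \<Rightarrow> bool list pmf) \<Rightarrow> nat \<Rightarrow> formula pmf" where
  "mu_and_or L \<mu> n = map_pmf (select (L n)) (\<mu> n)"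

text \<open>The list as a word: the concatenated incidence vectors of its members.\<close>

definition describe :: "(nat \<Rightarrow> nat set list) \<Rightarrow> nat \<Rightarrow> bool list" where
  "describe L n = concat (map (\<lambda>T. map (\<lambda>i. i \<in> T) [0..<n]) (L n))"

end

theory Submission imports Defs begin

text \<open>
  The list \<open>L\<close> is part of the learner's input, so the target is a conjunction over a known set of
  polynomially many features, and the classical elimination algorithm works for every formula in the
  support of the distribution: start with all disjunctions of \<open>L\<close>, discard those falsified by some
  positive example, and output the rest.  The hypothesis errs only where the target holds and a
  surviving disjunction fails.  A disjunction that fails with probability \<open>p\<close> on positive examples
  survives \<open>M\<close> examples with probability \<open>(1 - p) ^ M\<close>, and \<open>p * (1 - p) ^ M \<le> 1 / M\<close>, so the
  expected error is at most \<open>length L / M\<close>; Markov's inequality shows that \<open>M \<ge> length L / (\<epsilon> * \<delta>)\<close>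
  examples suffice.
\<close>


section \<open>Big-step reasoning about machines\<close>

text \<open>
  The running time may depend on the random choices; the witness \<open>R\<close> therefore records it jointly
  with the final stacks, whereas \<open>D\<close> forgets it and only the worst-case bound \<open>T\<close> is kept.
\<close>

definition computes :: "bool list pmf \<Rightarrow> cmd list \<Rightarrow> stacks \<Rightarrow> nat \<Rightarrow> stacks pmf \<Rightarrow> bool" where
  "computes orc P s T D \<longleftrightarrow> (\<exists>R. map_pmf fst R = D \<and> (\<forall>x\<in>set_pmf R. snd x \<le> T) \<and>
     (\<forall>rest t. T \<le> t \<longrightarrow>
        steps orc t (P @ rest, s) = bind_pmf R (\<lambda>x. steps orc (t - snd x) (rest, fst x))))"

lemma computes_Nil: "computes orc [] s 0 (return_pmf s)"
  unfolding computes_def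
  by (rule exI[of _ "return_pmf (s, 0)"]) (simp add: bind_return_pmf)

text \<open>Keeping \<open>D = D'\<close> as a premise allows resolution with any program lemma; the
  comparison of the final stacks is left as a goal for \<open>fun_eq_iff\<close>.\<close>

lemma computes_weaken:
  "computes orc P s T D \<Longrightarrow> T \<le> T' \<Longrightarrow> D = D' \<Longrightarrow> computes orc P s T' D'"
  unfolding computes_def by (elim exE, rule_tac x = R in exI) (auto intro: order_trans)

lemma computes_step:
  assumes "\<And>rest. step orc (P @ rest, s) = return_pmf (P' @ rest, s')"
    and "computes orc P' s' T D"
  shows "computes orc P s (Suc T) D"
proof -
  obtain R where R: "map_pmf fst R = D" "\<forall>x\<in>set_pmf R. snd x \<le> T"
    "\<And>rest t. T \<le> t \<Longrightarrow>
        steps orc t (P' @ rest, s') = bind_pmf R (\<lambda>x. steps orc (t - snd x) (rest, fst x))"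
    using assms(2) unfolding computes_def by blast
  have "steps orc t (P @ rest, s) =
      bind_pmf (map_pmf (apsnd Suc) R) (\<lambda>x. steps orc (t - snd x) (rest, fst x))"
    if T: "Suc T \<le> t" for rest t
  proof -
    obtain t' where t': "t = Suc t'" "T \<le> t'" using T by (cases t) auto
    show ?thesis using R(3)[OF t'(2)] by (simp add: t' assms(1) bind_return_pmf bind_map_pmf)
  qed
  then show ?thesis
    unfolding computes_def using R(1,2)
    by (intro exI[of _ "map_pmf (apsnd Suc) R"]) (auto simp: pmf.map_comp o_def)
qed

text \<open>Actual running times are added run by run, so the joint witness for the second phase may
  depend on the outcome of the first; only the bounds are uniform over the support.\<close>

lemma computes_bind:
  assumes "computes orc P s T1 D"
    and "\<And>s'. s' \<in> set_pmf D \<Longrightarrow> computes orc Q s' T2 (K s')"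
  shows "computes orc (P @ Q) s (T1 + T2) (bind_pmf D K)"
proof -
  obtain R where R: "map_pmf fst R = D" "\<And>x. x\<in>set_pmf R \<Longrightarrow> snd x \<le> T1"
    "\<And>rest t. T1 \<le> t \<Longrightarrow>
        steps orc t (P @ rest, s) = bind_pmf R (\<lambda>x. steps orc (t - snd x) (rest, fst x))"
    using assms(1) unfolding computes_def by blast
  \<comment> \<open>Packing the three properties into one predicate lets a single use of choice pick
    a witness for every state in the support.\<close>
  define good where "good s' R' \<longleftrightarrow> map_pmf fst R' = K s' \<and> (\<forall>x\<in>set_pmf R'. snd x \<le> T2) \<and>
     (\<forall>rest t. T2 \<le> t \<longrightarrow>
        steps orc t (Q @ rest, s') = bind_pmf R' (\<lambda>x. steps orc (t - snd x) (rest, fst x)))"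
    for s' R'
  have "\<exists>R'. good s' R'" if "s' \<in> set_pmf D" for s'
    using assms(2)[OF that] unfolding computes_def good_def .
  then obtain R' where "\<And>s'. s' \<in> set_pmf D \<Longrightarrow> good s' (R' s')"
    by metis
  then have R': "\<And>s'. s' \<in> set_pmf D \<Longrightarrow> map_pmf fst (R' s') = K s'"
    "\<And>s' x. s' \<in> set_pmf D \<Longrightarrow> x\<in>set_pmf (R' s') \<Longrightarrow> snd x \<le> T2"
    "\<And>s' rest t. s' \<in> set_pmf D \<Longrightarrow> T2 \<le> t \<Longrightarrow>
        steps orc t (Q @ rest, s') = bind_pmf (R' s') (\<lambda>x. steps orc (t - snd x) (rest, fst x))"
    unfolding good_def by blast+
  have D: "fst x \<in> set_pmf D" if "x \<in> set_pmf R" for x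
    using that R(1) by auto
  let ?R = "bind_pmf R (\<lambda>x. map_pmf (apsnd ((+) (snd x))) (R' (fst x)))"
  have "map_pmf fst ?R = bind_pmf R (\<lambda>x. K (fst x))"
    unfolding map_bind_pmf
    by (rule bind_pmf_cong[OF refl]) (simp add: pmf.map_comp o_def R'(1)[OF D])
  then have 1: "map_pmf fst ?R = bind_pmf D K"
    by (simp add: R(1)[symmetric] bind_map_pmf)
  have 2: "\<forall>x\<in>set_pmf ?R. snd x \<le> T1 + T2"
  proof
    fix x assume "x \<in> set_pmf ?R"
    then obtain y z where "y \<in> set_pmf R" "z \<in> set_pmf (R' (fst y))" "snd x = snd y + snd z"
      by auto
    then show "snd x \<le> T1 + T2" using R(2)[of y] R'(2)[OF D, of y z] by simp
  qed
  have 3: "steps orc t ((P @ Q) @ rest, s) = bind_pmf ?R (\<lambda>x. steps orc (t - snd x) (rest, fst x))"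
    if t: "T1 + T2 \<le> t" for rest t
  proof -
    have "steps orc t ((P @ Q) @ rest, s) =
        bind_pmf R (\<lambda>x. steps orc (t - snd x) (Q @ rest, fst x))"
      using R(3)[of t "Q @ rest"] t by simp
    also have "\<dots> = bind_pmf R (\<lambda>x. bind_pmf (R' (fst x))
        (\<lambda>y. steps orc (t - snd x - snd y) (rest, fst y)))"
    proof (rule bind_pmf_cong[OF refl])
      fix x assume x: "x \<in> set_pmf R"
      then have "T2 \<le> t - snd x" using R(2)[OF x] t by linarith
      then show "steps orc (t - snd x) (Q @ rest, fst x) =
          bind_pmf (R' (fst x)) (\<lambda>y. steps orc (t - snd x - snd y) (rest, fst y))"
        using R'(3)[OF D[OF x]] by simp
    qed
    finally show ?thesis by (simp add: bind_assoc_pmf bind_map_pmf)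
  qed
  show ?thesis unfolding computes_def
    by (intro exI[of _ ?R] conjI allI impI 1 2 3)
qed

lemma computes_Cons:
  assumes "computes orc [c] s T1 (return_pmf s')" and "computes orc Q s' T2 D"
  shows "computes orc (c # Q) s (T1 + T2) D"
  using computes_bind[OF assms(1), of Q T2 "\<lambda>_. D"] assms(2) by (simp add: bind_return_pmf)

text \<open>These functions let the simplifier run loop-free deterministic code symbolically.\<close>

fun loop_free :: "cmd list \<Rightarrow> bool" where
  "loop_free [] \<longleftrightarrow> True"
| "loop_free (Push r b # cs) \<longleftrightarrow> loop_free cs"
| "loop_free (Pop r # cs) \<longleftrightarrow> loop_free cs"
| "loop_free (Cond t ps qs # cs) \<longleftrightarrow> loop_free ps \<and> loop_free qs \<and> loop_free cs"
| "loop_free _ \<longleftrightarrow> False"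

fun straight :: "cmd list \<Rightarrow> stacks \<Rightarrow> stacks" where
  "straight (Push r b # cs) s = straight cs (s(r := b # s r))"
| "straight (Pop r # cs) s = straight cs (s(r := tl (s r)))"
| "straight (Cond t ps qs # cs) s = straight cs (if holds t s then straight ps s else straight qs s)"
| "straight _ s = s"

fun cost :: "cmd list \<Rightarrow> nat" where
  "cost (Push r b # cs) = Suc (cost cs)"
| "cost (Pop r # cs) = Suc (cost cs)"
| "cost (Cond t ps qs # cs) = Suc (max (cost ps) (cost qs) + cost cs)"
| "cost _ = 0"

lemma computes_straight:
  "loop_free P \<Longrightarrow> computes orc P s (cost P) (return_pmf (straight P s))"
proof (induction P arbitrary: s rule: loop_free.induct)
  case 1
  then show ?case by (simp add: computes_Nil)
next
  case (2 r b cs)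
  then show ?case by (auto intro!: computes_step[of orc "Push r b # cs" s cs])
next
  case (3 r cs)
  then show ?case by (auto intro!: computes_step[of orc "Pop r # cs" s cs])
next
  case (4 t ps qs cs)
  let ?s' = "if holds t s then straight ps s else straight qs s"
  \<comment> \<open>Either branch fits into the larger of the two costs, which makes
    \<open>cost\<close> independent of the stacks.\<close>
  have "computes orc (if holds t s then ps else qs) s (max (cost ps) (cost qs)) (return_pmf ?s')"
    using 4 by (auto intro: computes_weaken[OF _ max.cobounded1 refl]
        computes_weaken[OF _ max.cobounded2 refl])
  from computes_bind[OF this, of cs "cost cs" "\<lambda>_. return_pmf (straight cs ?s')"]
  have "computes orc ((if holds t s then ps else qs) @ cs) s
      (max (cost ps) (cost qs) + cost cs) (return_pmf (straight cs ?s'))"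
    using 4 by (simp add: bind_return_pmf)
  then show ?case
    by (auto intro!: computes_step[of orc "Cond t ps qs # cs" s "(if holds t s then ps else qs) @ cs"])
qed auto

lemma computes_straight':
  "loop_free P \<Longrightarrow> cost P \<le> T \<Longrightarrow> straight P s = s' \<Longrightarrow> computes orc P s T (return_pmf s')"
  using computes_straight computes_weaken by metis

lemma computes_Cond:
  assumes "computes orc (if holds t s then ps else qs) s T D"
  shows "computes orc [Cond t ps qs] s (Suc T) D"
  by (rule computes_step[OF _ assms]) simp

lemma computes_Loop_exit:
  assumes "\<not> holds t s"
  shows "computes orc [Loop t ps] s 1 (return_pmf s)"
  using computes_step[of orc "[Loop t ps]" s "[]" s 0] assms by (simp add: computes_Nil)

text \<open>The additional step is the loop test. Loops are verified by unfolding one round and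
  inducting over the contents of the stack that the test inspects.\<close>

lemma computes_Loop_bind:
  assumes "holds t s" and "computes orc ps s T1 D"
    and "\<And>s'. s' \<in> set_pmf D \<Longrightarrow> computes orc [Loop t ps] s' T2 (K s')"
  shows "computes orc [Loop t ps] s (Suc (T1 + T2)) (bind_pmf D K)"
  by (rule computes_step[OF _ computes_bind[OF assms(2,3)]]) (use assms(1) in auto)

lemma computes_Loop:
  assumes "holds t s" and "computes orc ps s T1 (return_pmf s')"
    and "computes orc [Loop t ps] s' T2 D"
  shows "computes orc [Loop t ps] s (Suc (T1 + T2)) D"
  using computes_Loop_bind[OF assms(1,2), of T2 "\<lambda>_. D"] assms(3) by (simp add: bind_return_pmf)

lemma computes_Query: "computes orc [Query r] s 1 (map_pmf (\<lambda>w. s(r := w)) orc)"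
  unfolding computes_def
proof (intro exI[of _ "map_pmf (\<lambda>w. (s(r := w), 1)) orc"] conjI allI impI)
  fix rest t assume "1 \<le> (t::nat)"
  then obtain t' where "t = Suc t'" by (cases t) auto
  then show "steps orc t ([Query r] @ rest, s) =
      bind_pmf (map_pmf (\<lambda>w. (s(r := w), 1)) orc) (\<lambda>x. steps orc (t - snd x) (rest, fst x))"
    by (simp add: bind_map_pmf)
qed (auto simp: pmf.map_comp o_def)

lemma computes_steps:
  assumes "computes orc P s T D" and "T \<le> t"
  shows "steps orc t (P, s) = map_pmf (Pair []) D"
proof -
  obtain R where R: "map_pmf fst R = D"
    "\<And>rest t. T \<le> t \<Longrightarrow>
        steps orc t (P @ rest, s) = bind_pmf R (\<lambda>x. steps orc (t - snd x) (rest, fst x))"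
    using assms(1) unfolding computes_def by blast
  \<comment> \<open>With an empty continuation the time left over is spent in a halted
    configuration, where nothing changes.\<close>
  show ?thesis
    using R(2)[OF assms(2), of "[]"]
    by (simp add: steps_halted R(1)[symmetric] pmf.map_comp o_def map_pmf_def[symmetric])
qed


section \<open>Stack programs\<close>

definition move :: "nat \<Rightarrow> nat \<Rightarrow> cmd" where
  "move r q = Loop (Nonempty r) [Cond (Top r) [Push q True] [Push q False], Pop r]"

definition clear :: "nat \<Rightarrow> cmd" where
  "clear r = Loop (Nonempty r) [Pop r]"

text \<open>Every bit costs four steps (test, conditional, push, pop) and the failing test one more.
  The order is reversed, so two moves restore it.\<close>

lemma computes_move:
  assumes "r \<noteq> q"
  shows "computes orc [move r q] s (4 * length (s r) + 1)
     (return_pmf (s(r := [], q := rev (s r) @ s q)))"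
proof (induction "s r" arbitrary: s)
  case Nil
  then show ?case unfolding move_def
    by (intro computes_weaken[OF computes_Loop_exit]) (auto simp: fun_eq_iff)
next
  case (Cons a xs)
  let ?s = "s(r := xs, q := a # s q)"
  have 1: "computes orc [Cond (Top r) [Push q True] [Push q False], Pop r] s 3 (return_pmf ?s)"
    using Cons(2)[symmetric] assms by (intro computes_straight') (auto simp: fun_eq_iff)
  have 2: "computes orc [move r q] ?s (4 * length xs + 1)
     (return_pmf (?s(r := [], q := rev xs @ a # s q)))"
    using Cons(1)[of ?s] assms by simp
  show ?case
    using computes_Loop[OF _ 1 2[unfolded move_def]] Cons(2)[symmetric] assms
    by (auto elim!: computes_weaken simp: move_def fun_eq_iff)
qed

lemma computes_clear:
  "computes orc [clear r] s (2 * length (s r) + 1) (return_pmf (s(r := [])))"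
proof (induction "s r" arbitrary: s)
  case Nil
  then show ?case unfolding clear_def
    by (intro computes_weaken[OF computes_Loop_exit]) (auto simp: fun_eq_iff)
next
  case (Cons a xs)
  let ?s = "s(r := xs)"
  have 1: "computes orc [Pop r] s 1 (return_pmf ?s)"
    using Cons(2)[symmetric]
    by (intro computes_straight') auto
  have 2: "computes orc [clear r] ?s (2 * length xs + 1) (return_pmf (s(r := [])))"
    using Cons(1)[of ?s] by simp
  show ?case
    using computes_Loop[OF _ 1 2[unfolded clear_def]] Cons(2)[symmetric]
    by (auto elim!: computes_weaken simp: clear_def)
qed

text \<open>Unary multiplication by repeated addition: \<open>b'\<close> is scratch space from which
  \<open>b\<close> is restored after each pass, while \<open>a\<close> is used up as the
  counter.\<close>

definition multiply :: "nat \<Rightarrow> nat \<Rightarrow> nat \<Rightarrow> nat \<Rightarrow> cmd" where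
  "multiply a b b' c = Loop (Nonempty a)
     [Pop a,
      Loop (Nonempty b) [Push c True, Cond (Top b) [Push b' True] [Push b' False], Pop b],
      move b' b]"

lemma computes_count:
  assumes "distinct [b, b', c]"
  shows "computes orc
     [Loop (Nonempty b) [Push c True, Cond (Top b) [Push b' True] [Push b' False], Pop b]]
     s (5 * length (s b) + 1)
     (return_pmf (s(b := [], b' := rev (s b) @ s b', c := replicate (length (s b)) True @ s c)))"
proof (induction "s b" arbitrary: s)
  case Nil
  then show ?case
    by (intro computes_weaken[OF computes_Loop_exit]) (auto simp: fun_eq_iff)
next
  case (Cons x xs)
  let ?ps = "[Push c True, Cond (Top b) [Push b' True] [Push b' False], Pop b]"
  let ?s = "s(b := xs, b' := x # s b', c := True # s c)"
  have 1: "computes orc ?ps s 4 (return_pmf ?s)"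
    using Cons(2)[symmetric] assms by (intro computes_straight') (auto simp: fun_eq_iff)
  have 2: "computes orc [Loop (Nonempty b) ?ps] ?s (5 * length xs + 1)
     (return_pmf (s(b := [], b' := rev xs @ x # s b', c := replicate (length xs) True @ True # s c)))"
    using assms by (intro computes_weaken[OF Cons(1)]) (auto simp: fun_eq_iff)
  show ?case
    using computes_Loop[OF _ 1 2] Cons(2)[symmetric] assms
    by (auto elim!: computes_weaken simp: replicate_app_Cons_same fun_eq_iff)
qed

lemma computes_multiply:
  assumes "distinct [a, b, b', c]" and "s b' = []"
  shows "computes orc [multiply a b b' c] s (length (s a) * (9 * length (s b) + 4) + 1)
     (return_pmf (s(a := [], c := replicate (length (s a) * length (s b)) True @ s c)))"
  using assms(2)
proof (induction "s a" arbitrary: s)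
  case Nil
  then show ?case unfolding multiply_def
    by (intro computes_weaken[OF computes_Loop_exit]) (auto simp: fun_eq_iff)
next
  case (Cons x xs)
  let ?c = "Loop (Nonempty b) [Push c True, Cond (Top b) [Push b' True] [Push b' False], Pop b]"
  let ?k = "length (s b)"
  let ?s = "s(a := xs, c := replicate ?k True @ s c)"
  have 1: "computes orc [Pop a, ?c, move b' b] s (9 * ?k + 3) (return_pmf ?s)"
  proof -
    let ?s1 = "s(a := xs)"
    let ?s2 = "?s1(b := [], b' := rev (s b), c := replicate ?k True @ s c)"
    have 1: "computes orc [Pop a] s 1 (return_pmf ?s1)"
      using Cons(2)[symmetric] by (intro computes_straight') auto
    have 2: "computes orc [?c] ?s1 (5 * ?k + 1) (return_pmf ?s2)"
      using assms Cons(3) by (intro computes_weaken[OF computes_count]) (auto simp: fun_eq_iff)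
    have 3: "computes orc [move b' b] ?s2 (4 * ?k + 1) (return_pmf ?s)"
      using assms Cons(3) by (intro computes_weaken[OF computes_move]) (auto simp: fun_eq_iff)
    from computes_Cons[OF 1 computes_Cons[OF 2 3]] show ?thesis
      by (rule computes_weaken) auto
  qed
  have 2: "computes orc [multiply a b b' c] ?s (length xs * (9 * ?k + 4) + 1)
     (return_pmf (s(a := [], c := replicate (length (s a) * ?k) True @ s c)))"
    using assms Cons(2)[symmetric] Cons(3)
    by (intro computes_weaken[OF Cons(1)])
      (auto simp: fun_eq_iff replicate_add[symmetric] add.commute append_assoc[symmetric]
        simp del: append_assoc)
  show ?case
    using computes_Loop[OF _ 1 2[unfolded multiply_def]] Cons(2)[symmetric]
    by (auto elim!: computes_weaken simp: multiply_def)
qed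


section \<open>Discarding the disjunctions that an example falsifies\<close>

text \<open>
  A word is read as a sequence of incidence vectors as long as the example.  The padding matters
  only for ill-formed words, on which the evaluator must halt as well.
\<close>

primrec pad :: "nat \<Rightarrow> bool list \<Rightarrow> bool list" where
  "pad 0 w = []"
| "pad (Suc k) w = (w \<noteq> [] \<and> hd w) # pad k (tl w)"

primrec hits :: "bool list \<Rightarrow> bool list \<Rightarrow> nat" where
  "hits [] w = 0"
| "hits (a # x) w = (if a \<and> w \<noteq> [] \<and> hd w then 1 else 0) + hits x (tl w)"

definition meets :: "bool list \<Rightarrow> bool list \<Rightarrow> bool" where
  "meets x b \<longleftrightarrow> hits x b \<noteq> 0"

lemma length_pad [simp]: "length (pad k w) = k"
  by (induction k arbitrary: w) auto

lemma hits_le: "hits x w \<le> length x"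
  by (induction x arbitrary: w) (auto intro: le_SucI)

text \<open>Padding bits are \<open>False\<close>, and so is the verdict on a missing bit.\<close>

lemma hits_pad: "hits x (pad (length x) w) = hits x w"
  by (induction x arbitrary: w) auto

lemma pad_append: "length b = k \<Longrightarrow> pad k (b @ w) = b"
  by (induction k arbitrary: b) (auto simp: length_Suc_conv)

lemma meets_iff: "length b = length x \<Longrightarrow> meets x b \<longleftrightarrow> (\<exists>i < length x. x ! i \<and> b ! i)"
  unfolding meets_def
proof (induction x b rule: list_induct2')
  case (4 a x c b)
  then show ?case by (auto simp: less_Suc_eq_0_disj)
qed auto

text \<open>The case \<open>k = 0\<close> is cut off because dropping no bits would never shorten
  the word.\<close>

function chunks :: "nat \<Rightarrow> bool list \<Rightarrow> bool list list" where
  "chunks k w = (if k = 0 \<or> w = [] then [] else pad k w # chunks k (drop k w))"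
  by auto
termination by (relation "Wellfounded.measure (length \<circ> snd)") auto

declare chunks.simps [simp del]

lemma length_chunks: "length (chunks k w) \<le> length w"
  by (induction k w rule: chunks.induct) (subst chunks.simps, auto simp: Suc_le_eq le_less_trans)

lemma chunks_concat:
  assumes "k > 0" and "\<And>b. b \<in> set bs \<Longrightarrow> length b = k"
  shows "chunks k (concat bs) = bs"
  using assms(2)
proof (induction bs)
  case Nil
  then show ?case by (simp add: chunks.simps)
next
  case (Cons b bs)
  then show ?case using assms(1) by (subst chunks.simps) (auto simp: pad_append)
qed

section \<open>The filtering machine\<close>

text \<open>
  Stack 0 holds the remaining vectors, 1 the example, 6 the part of it that has been read.  Vectors
  are moved in reverse to stack 5 and taken back from there if they turn out not to meet the
  example.  Stack 7 counts the hits of the current vector, 8 the discarded vectors.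
\<close>

definition scan :: cmd where
  "scan = Loop (Nonempty 1)
     [Cond (Top 1) [Push 6 True, Cond (Top 0) [Push 7 True] []] [Push 6 False],
      Cond (Top 0) [Push 5 True] [Push 5 False], Pop 0, Pop 1]"

definition unscan :: cmd where
  "unscan = Loop (Nonempty 6)
     [Cond (Top 6) [Push 1 True] [Push 1 False], Pop 6, Cond (Nonempty 7) [] [Pop 5]]"

definition filt :: cmd where
  "filt = Loop (Nonempty 0) [scan, unscan, Cond (Nonempty 7) [clear 7] [Push 8 True]]"

lemma computes_scan:
  "computes orc [scan] s (9 * length (s 1) + 1)
     (return_pmf (s(1 := [], 6 := rev (s 1) @ s 6, 0 := drop (length (s 1)) (s 0),
        5 := rev (pad (length (s 1)) (s 0)) @ s 5, 7 := replicate (hits (s 1) (s 0)) True @ s 7)))"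
proof (induction "s 1" arbitrary: s)
  case Nil
  then show ?case unfolding scan_def
    by (intro computes_weaken[OF computes_Loop_exit]) (auto simp: fun_eq_iff)
next
  case (Cons a xs)
  let ?c = "s 0 \<noteq> [] \<and> hd (s 0)"
  let ?s = "s(1 := xs, 6 := a # s 6, 0 := tl (s 0), 5 := ?c # s 5,
    7 := (if a \<and> ?c then [True] else []) @ s 7)"
  have 1: "computes orc [Cond (Top 1) [Push 6 True, Cond (Top 0) [Push 7 True] []] [Push 6 False],
      Cond (Top 0) [Push 5 True] [Push 5 False], Pop 0, Pop 1] s 8 (return_pmf ?s)"
    using Cons(2)[symmetric] by (intro computes_straight') (auto simp: fun_eq_iff)
  have 2: "computes orc [scan] ?s (9 * length xs + 1)
     (return_pmf (s(1 := [], 6 := rev (a # xs) @ s 6, 0 := drop (length (a # xs)) (s 0),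
        5 := rev (pad (length (a # xs)) (s 0)) @ s 5,
        7 := replicate (hits (a # xs) (s 0)) True @ s 7)))"
    by (intro computes_weaken[OF Cons(1)])
      (auto simp: fun_eq_iff drop_Suc replicate_app_Cons_same)
  show ?case
    using computes_Loop[OF _ 1 2[unfolded scan_def]] Cons(2)[symmetric]
    by (auto elim!: computes_weaken simp: scan_def)
qed

text \<open>One bit of stack 5 is popped per bit of the example, so in the absence of hits exactly
  the vector that \<open>scan\<close> has just copied disappears.\<close>

lemma computes_unscan:
  "computes orc [unscan] s (6 * length (s 6) + 1)
     (return_pmf (s(6 := [], 1 := rev (s 6) @ s 1,
        5 := (if s 7 = [] then drop (length (s 6)) (s 5) else s 5))))"
proof (induction "s 6" arbitrary: s)
  case Nil
  then show ?case unfolding unscan_def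
    by (intro computes_weaken[OF computes_Loop_exit]) (auto simp: fun_eq_iff)
next
  case (Cons a xs)
  let ?s = "s(6 := xs, 1 := a # s 1, 5 := (if s 7 = [] then tl (s 5) else s 5))"
  have 1: "computes orc [Cond (Top 6) [Push 1 True] [Push 1 False], Pop 6, Cond (Nonempty 7) [] [Pop 5]]
      s 5 (return_pmf ?s)"
    using Cons(2)[symmetric] by (intro computes_straight') (auto simp: fun_eq_iff)
  have 2: "computes orc [unscan] ?s (6 * length xs + 1)
     (return_pmf (s(6 := [], 1 := rev (a # xs) @ s 1,
        5 := (if s 7 = [] then drop (length (a # xs)) (s 5) else s 5))))"
    by (intro computes_weaken[OF Cons(1)]) (auto simp: fun_eq_iff drop_Suc)
  show ?case
    using computes_Loop[OF _ 1 2[unfolded unscan_def]] Cons(2)[symmetric]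
    by (auto elim!: computes_weaken simp: unscan_def)
qed

lemma computes_filt_body:
  assumes "s 6 = []" and "s 7 = []"
  shows "computes orc [scan, unscan, Cond (Nonempty 7) [clear 7] [Push 8 True]] s
     (17 * length (s 1) + 4)
     (return_pmf (s(0 := drop (length (s 1)) (s 0),
        5 := (if meets (s 1) (s 0) then rev (pad (length (s 1)) (s 0)) else []) @ s 5,
        8 := (if meets (s 1) (s 0) then [] else [True]) @ s 8)))"
    (is "computes _ _ _ _ (return_pmf ?s)")
proof -
  let ?s1 = "s(1 := [], 6 := rev (s 1), 0 := drop (length (s 1)) (s 0),
        5 := rev (pad (length (s 1)) (s 0)) @ s 5, 7 := replicate (hits (s 1) (s 0)) True)"
  let ?s2 = "s(0 := drop (length (s 1)) (s 0),
        5 := (if meets (s 1) (s 0) then rev (pad (length (s 1)) (s 0)) else []) @ s 5,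
        7 := replicate (hits (s 1) (s 0)) True)"
  have 1: "computes orc [scan] s (9 * length (s 1) + 1) (return_pmf ?s1)"
    using assms by (intro computes_weaken[OF computes_scan]) (auto simp: fun_eq_iff)
  have 2: "computes orc [unscan] ?s1 (6 * length (s 1) + 1) (return_pmf ?s2)"
    by (intro computes_weaken[OF computes_unscan]) (auto simp: fun_eq_iff meets_def assms)
  have 3: "computes orc [Cond (Nonempty 7) [clear 7] [Push 8 True]] ?s2
      (Suc (2 * length (s 1) + 1)) (return_pmf ?s)"
  proof (rule computes_Cond)
    show "computes orc (if holds (Nonempty 7) ?s2 then [clear 7] else [Push 8 True]) ?s2
      (2 * length (s 1) + 1) (return_pmf ?s)"
    proof (cases "meets (s 1) (s 0)")
      case True
      have "computes orc [clear 7] ?s2 (2 * length (s 1) + 1) (return_pmf ?s)"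
        \<comment> \<open>Stack 7 holds at most one mark per bit of the example, which bounds the
          time for clearing it.\<close>
        using assms True hits_le[of "s 1" "s 0"]
        by (intro computes_weaken[OF computes_clear]) (auto simp: fun_eq_iff)
      then show ?thesis using True by (simp add: meets_def)
    next
      case False
      have "computes orc [Push 8 True] ?s2 (2 * length (s 1) + 1) (return_pmf ?s)"
        using assms False by (intro computes_straight') (auto simp: fun_eq_iff meets_def)
      then show ?thesis using False by (simp add: meets_def)
    qed
  qed
  from computes_Cons[OF 1 computes_Cons[OF 2 3]] show ?thesis
    by (rule computes_weaken) auto
qed

lemma computes_filt:
  assumes "s 1 = x" "x \<noteq> []" "s 6 = []" "s 7 = []"
  shows "computes orc [filt] s (length (chunks (length x) (s 0)) * (17 * length x + 5) + 1)
     (return_pmf (s(0 := [],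
        5 := rev (concat (filter (meets x) (chunks (length x) (s 0)))) @ s 5,
        8 := replicate (length (filter (\<lambda>b. \<not> meets x b) (chunks (length x) (s 0)))) True @ s 8)))"
  using assms
proof (induction "length x" "s 0" arbitrary: s rule: chunks.induct)
  case 1
  show ?case
  proof (cases "s 0 = []")
    case True
    then show ?thesis unfolding filt_def
      by (intro computes_weaken[OF computes_Loop_exit]) (auto simp: fun_eq_iff chunks.simps)
  next
    case False
    let ?s = "s(0 := drop (length (s 1)) (s 0),
        5 := (if meets (s 1) (s 0) then rev (pad (length (s 1)) (s 0)) else []) @ s 5,
        8 := (if meets (s 1) (s 0) then [] else [True]) @ s 8)"
    let ?c = "chunks (length x) (s 0)" and ?c' = "chunks (length x) (?s 0)"
    have c: "?c = pad (length x) (s 0) # ?c'"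
      using False 1 by (subst chunks.simps) simp
    \<comment> \<open>The machine tests the unpadded remainder of stack 0, whereas
      \<open>chunks\<close> lists padded blocks.\<close>
    have m: "meets x (pad (length x) (s 0)) = meets x (s 0)"
      by (simp add: meets_def hits_pad)
    have 2: "computes orc [filt] ?s (length ?c' * (17 * length x + 5) + 1)
     (return_pmf (s(0 := [], 5 := rev (concat (filter (meets x) ?c)) @ s 5,
        8 := replicate (length (filter (\<lambda>b. \<not> meets x b) ?c)) True @ s 8)))"
      using 1 False unfolding c
      by (intro computes_weaken[OF 1(1)]) (auto simp: fun_eq_iff m replicate_app_Cons_same)
    show ?thesis
      using computes_Loop[OF _ computes_filt_body 2[unfolded filt_def]] 1 False
      unfolding c filt_def by (auto elim!: computes_weaken simp: algebra_simps)
  qed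
qed

section \<open>Evaluating hypotheses in polynomial time\<close>

lemma computes_initial:
  assumes "computes orc P (\<lambda>r. if r < length ws then ws ! r else []) T D" and "T \<le> t"
  shows "halts_within orc P ws t" and "final_output orc P ws t = map_pmf (\<lambda>s. s 0) D"
  using computes_steps[OF assms]
  by (auto simp: halts_within_def final_output_def initial_def pmf.map_comp o_def)

text \<open>The argument's length serves as block length for decoding, so a representation needs no
  header.\<close>

definition hyp :: "bool list \<Rightarrow> bool list \<Rightarrow> bool" where
  "hyp w x \<longleftrightarrow> (\<forall>b\<in>set (chunks (length x) w). meets x b)"

text \<open>The hypothesis holds iff filtering by the argument discards nothing, that is, iff stack
  8 stays empty. An empty argument is treated apart because \<open>filt\<close> would then never
  shorten a nonempty stack 0.\<close>

definition evaluator :: "cmd list" where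
  "evaluator = [Cond (Nonempty 1)
     [filt, Cond (Nonempty 8) [Push 0 False] [Push 0 True]] [clear 0, Push 0 True]]"

lemma computes_evaluator:
  fixes s :: stacks
  assumes "s 6 = []" "s 7 = []" "s 8 = []"
  obtains s' where
    "computes orc evaluator s (30 * (length (s 0) + length (s 1) + 1) ^ 2) (return_pmf s')"
    "s' 0 = [hyp (s 0) (s 1)]"
proof (cases "s 1 = []")
  case True
  let ?s' = "s(0 := [True])"
  have "computes orc [clear 0] s (2 * length (s 0) + 1) (return_pmf (s(0 := [])))"
    by (rule computes_clear)
  moreover have "computes orc [Push 0 True] (s(0 := [])) 1 (return_pmf ?s')"
    by (intro computes_straight') auto
  ultimately have "computes orc [clear 0, Push 0 True] s (2 * length (s 0) + 1 + 1) (return_pmf ?s')"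
    by (rule computes_Cons)
  then have "computes orc evaluator s (Suc (2 * length (s 0) + 1 + 1)) (return_pmf ?s')"
    unfolding evaluator_def using True by (intro computes_Cond) simp
  then have "computes orc evaluator s (30 * (length (s 0) + length (s 1) + 1) ^ 2) (return_pmf ?s')"
    by (rule computes_weaken) (auto simp: power2_eq_square algebra_simps)
  then show ?thesis
    using True by (intro that[of ?s']) (auto simp: hyp_def chunks.simps)
next
  case False
  let ?c = "chunks (length (s 1)) (s 0)"
  let ?T = "length ?c * (17 * length (s 1) + 5) + 1"
  let ?s1 = "s(0 := [], 5 := rev (concat (filter (meets (s 1)) ?c)) @ s 5,
     8 := replicate (length (filter (\<lambda>b. \<not> meets (s 1) b) ?c)) True)"
  let ?s' = "?s1(0 := [hyp (s 0) (s 1)])"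
  have "computes orc [filt] s ?T (return_pmf ?s1)"
    using assms False by (intro computes_weaken[OF computes_filt]) auto
  moreover have "computes orc [Cond (Nonempty 8) [Push 0 False] [Push 0 True]] ?s1 2
      (return_pmf ?s')"
    by (intro computes_straight') (auto simp: fun_eq_iff hyp_def filter_empty_conv)
  ultimately have "computes orc [filt, Cond (Nonempty 8) [Push 0 False] [Push 0 True]] s (?T + 2)
      (return_pmf ?s')"
    by (rule computes_Cons)
  then have *: "computes orc evaluator s (Suc (?T + 2)) (return_pmf ?s')"
    unfolding evaluator_def using False by (intro computes_Cond) simp
  \<comment> \<open>Each block uses up at least one bit of the word, so the time is at most bilinear
    in the two lengths, up to lower order terms.\<close>
  have "Suc (?T + 2) \<le> length (s 0) * (17 * length (s 1) + 5) + 4"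
    using length_chunks by simp
  also have "\<dots> \<le> 30 * (length (s 0) + length (s 1) + 1) ^ 2"
    by (simp add: power2_eq_square algebra_simps)
  finally have "computes orc evaluator s (30 * (length (s 0) + length (s 1) + 1) ^ 2) (return_pmf ?s')"
    using computes_weaken[OF *] by simp
  then show ?thesis by (rule that) simp
qed

lemma poly_time_evaluable_hyp: "poly_time_evaluable hyp"
  unfolding poly_time_evaluable_def
proof (rule exI[of _ evaluator], rule exI[of _ 30], rule exI[of _ 2], intro allI)
  fix w x :: "bool list"
  let ?s = "\<lambda>r. if r < length [w, x] then [w, x] ! r else []"
  obtain s' where "computes no_oracle evaluator ?s (30 * (length (?s 0) + length (?s 1) + 1) ^ 2)
      (return_pmf s')" and s': "s' 0 = [hyp (?s 0) (?s 1)]"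
    by (rule computes_evaluator[of ?s no_oracle]) auto
  then have "computes no_oracle evaluator ?s (30 * (length w + length x + 1) ^ 2) (return_pmf s')"
    by simp
  from computes_initial[OF this order_refl] s'
  show "let t = 30 * (length w + length x + 1) ^ 2 in
      halts_within no_oracle evaluator [w, x] t \<and>
      final_output no_oracle evaluator [w, x] t = return_pmf [hyp w x]"
    by simp
qed


section \<open>The learner\<close>

text \<open>The first move reverses the example and thereby brings its label to the top. Negative
  examples are erased; after a positive one the survivors return from stack 5 in their original
  order.\<close>

definition process :: "cmd list" where
  "process = [move 1 6,
     Cond (Top 6) [Pop 6, move 6 1, filt, move 5 0, clear 1, clear 8] [clear 6]]"

text \<open>
  Stack 10 receives the number of examples \<open>\<lceil>1/\<delta>\<rceil> * \<lceil>1/\<epsilon>\<rceil> * length d\<close> in unary, where \<open>d\<close> is the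
  description of the list.
\<close>

definition learner :: "cmd list" where
  "learner = [clear 0, move 4 9, multiply 1 9 4 5, multiply 2 5 6 10, clear 5, move 9 0,
     Loop (Nonempty 10) (Pop 10 # Query 1 # process)]"

section \<open>Elimination on lists and its machine implementation\<close>

text \<open>The last bit of a sample is its label.\<close>

definition refine :: "bool list \<Rightarrow> bool list list \<Rightarrow> bool list list" where
  "refine z bs = (if last z then filter (meets (butlast z)) bs else bs)"

lemma length_refine: "length (refine z bs) \<le> length bs"
  by (simp add: refine_def)

lemma set_refine: "set (refine z bs) \<subseteq> set bs"
  by (auto simp: refine_def)

lemma set_fold_refine:
  "set (fold refine zs bs) = {b \<in> set bs. \<forall>z\<in>set zs. last z \<longrightarrow> meets (butlast z) b}"
  by (induction zs arbitrary: bs) (auto simp: refine_def)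

lemma length_concat_blocks: "(\<And>b. b \<in> set bs \<Longrightarrow> length b = n) \<Longrightarrow> length (concat bs) = length bs * n"
  by (induction bs) auto

lemma computes_process:
  assumes n: "0 < n" and z: "s 1 = z" "length z = Suc n"
    and bs: "s 0 = concat bs" "\<And>b. b \<in> set bs \<Longrightarrow> length b = n" "length bs \<le> B"
    and s: "s 5 = []" "s 6 = []" "s 7 = []" "s 8 = []"
  shows "computes orc process s (40 * ((n + 1) * (B + 1)))
     (return_pmf (s(0 := concat (refine z bs), 1 := [])))"
proof -
  let ?T = "34 * n * B + 6 * n + 7 * B + 20"
  have len: "length (concat (filter P bs)) \<le> B * n" for P
  proof -
    have "length (concat (filter P bs)) = length (filter P bs) * n"
      using bs by (intro length_concat_blocks) auto
    also have "\<dots> \<le> B * n" using bs(3) order_trans[OF length_filter_le] by auto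
    finally show ?thesis .
  qed
  obtain x l where x: "z = x @ [l]" "length x = n"
    using z(2) by (metis length_Suc_conv_rev)
  let ?s1 = "s(1 := [], 6 := l # rev x)"
  let ?s' = "s(0 := concat (refine z bs), 1 := [])"
  have 1: "computes orc [move 1 6] s (4 * n + 5) (return_pmf ?s1)"
    using x z s by (intro computes_weaken[OF computes_move]) (auto simp: fun_eq_iff)
  let ?p = "[Pop 6, move 6 1, filt, move 5 0, clear 1, clear 8]"
  \<comment> \<open>The bounds for the six commands of the positive branch, nested as
    \<open>computes_Cons\<close> produces them; the negative branch is cheaper.\<close>
  let ?K = "1 + (4 * n + 1 + (B * (17 * n + 5) + 1 + (4 * (B * n) + 1 + (2 * n + 1 + (2 * B + 1)))))"
  have 2: "computes orc (if holds (Top 6) ?s1 then ?p else [clear 6]) ?s1 ?K (return_pmf ?s')"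
  proof (cases l)
    case True
    let ?b = "concat (filter (meets x) bs)"
    let ?d = "replicate (length (filter (\<lambda>b. \<not> meets x b) bs)) True"
    have d: "length ?d \<le> B" using bs(3) order_trans[OF length_filter_le] by auto
    have c: "chunks (length x) (concat bs) = bs"
      using n bs x by (intro chunks_concat) auto
    have p1: "computes orc [Pop 6] ?s1 1 (return_pmf (s(1 := [], 6 := rev x)))"
      by (intro computes_straight') (auto simp: fun_eq_iff)
    have p2: "computes orc [move 6 1] (s(1 := [], 6 := rev x)) (4 * n + 1) (return_pmf (s(1 := x)))"
      using x s by (intro computes_weaken[OF computes_move]) (auto simp: fun_eq_iff)
    have p3: "computes orc [filt] (s(1 := x)) (B * (17 * n + 5) + 1)
        (return_pmf (s(1 := x, 0 := [], 5 := rev ?b, 8 := ?d)))"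
      using x s n bs by (intro computes_weaken[OF computes_filt])
        (auto simp: fun_eq_iff c intro!: mult_right_mono)
    have p4: "computes orc [move 5 0] (s(1 := x, 0 := [], 5 := rev ?b, 8 := ?d)) (4 * (B * n) + 1)
        (return_pmf (s(1 := x, 0 := ?b, 8 := ?d)))"
      using s len[of "meets x"]
      by (intro computes_weaken[OF computes_move]) (auto simp: fun_eq_iff)
    have p5: "computes orc [clear 1] (s(1 := x, 0 := ?b, 8 := ?d)) (2 * n + 1)
        (return_pmf (s(1 := [], 0 := ?b, 8 := ?d)))"
      using x by (intro computes_weaken[OF computes_clear]) (auto simp: fun_eq_iff)
    have p6: "computes orc [clear 8] (s(1 := [], 0 := ?b, 8 := ?d)) (2 * B + 1) (return_pmf ?s')"
      using d s x True
      by (intro computes_weaken[OF computes_clear]) (auto simp: fun_eq_iff refine_def)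
    from computes_Cons[OF p1 computes_Cons[OF p2 computes_Cons[OF p3 computes_Cons[OF p4
      computes_Cons[OF p5 p6]]]]] True
    show ?thesis by simp
  next
    case False
    have "computes orc [clear 6] ?s1 ?K (return_pmf ?s')"
      using s x bs False
      by (intro computes_weaken[OF computes_clear]) (auto simp: fun_eq_iff refine_def)
    then show ?thesis using False by simp
  qed
  from computes_Cons[OF 1 computes_Cond[OF 2]] show ?thesis
    unfolding process_def by (rule computes_weaken) (auto simp: algebra_simps)
qed

text \<open>Drawing examples one by one inside the loop is the same as drawing \<open>M\<close>
  independent ones and folding \<open>refine\<close> over them. The induction generalizes over
  \<open>bs\<close>, which changes in every round.\<close>

lemma computes_samples:
  assumes n: "0 < n" and orc: "\<And>z. z \<in> set_pmf orc \<Longrightarrow> length z = Suc n"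
    and "s 0 = concat bs" "\<And>b. b \<in> set bs \<Longrightarrow> length b = n" "length bs \<le> B"
    and "s 1 = []" "s 5 = []" "s 6 = []" "s 7 = []" "s 8 = []" "s 10 = replicate M True"
  shows "computes orc [Loop (Nonempty 10) (Pop 10 # Query 1 # process)] s
     (M * (40 * ((n + 1) * (B + 1)) + 3) + 1)
     (map_pmf (\<lambda>zs. s(0 := concat (fold refine zs bs), 10 := [])) (replicate_pmf M orc))"
  using assms(3-)
proof (induction M arbitrary: s bs)
  case 0
  then show ?case
    by (intro computes_weaken[OF computes_Loop_exit]) (auto simp: fun_eq_iff)
next
  case (Suc M)
  let ?T = "40 * ((n + 1) * (B + 1))"
  let ?ps = "Pop 10 # Query 1 # process"
  let ?s1 = "s(10 := replicate M True)"
  let ?S = "\<lambda>z. ?s1(0 := concat (refine z bs))"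
  have p1: "computes orc [Pop 10] s 1 (return_pmf ?s1)"
    using Suc.prems by (intro computes_straight') (auto simp: fun_eq_iff)
  have p2: "computes orc ([Query 1] @ process) ?s1 (1 + ?T)
      (bind_pmf (map_pmf (\<lambda>w. ?s1(1 := w)) orc) (\<lambda>s'. return_pmf (?S (s' 1))))"
  proof (rule computes_bind[OF computes_Query])
    fix s' assume "s' \<in> set_pmf (map_pmf (\<lambda>w. ?s1(1 := w)) orc)"
    then obtain z where z: "z \<in> set_pmf orc" "s' = ?s1(1 := z)" by auto
    show "computes orc process s' ?T (return_pmf (?S (s' 1)))"
      unfolding z(2) using Suc.prems orc[OF z(1)] n
      by (intro computes_weaken[OF computes_process[of n _ z bs B]]) (auto simp: fun_eq_iff)
  qed
  have "bind_pmf (map_pmf (\<lambda>w. ?s1(1 := w)) orc) (\<lambda>s'. return_pmf (?S (s' 1))) = map_pmf ?S orc"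
    by (simp add: map_pmf_def[symmetric] pmf.map_comp o_def)
  with computes_Cons[OF p1 p2] have 1: "computes orc ?ps s (1 + (1 + ?T)) (map_pmf ?S orc)"
    by simp
  \<comment> \<open>The continuation may depend on the stacks only, so the current list is recovered
    from stack 0 with \<open>chunks\<close>.\<close>
  define K where "K s' =
    map_pmf (\<lambda>zs. s'(0 := concat (fold refine zs (chunks n (s' 0))), 10 := [])) (replicate_pmf M orc)"
    for s' :: stacks
  have 2: "computes orc [Loop (Nonempty 10) ?ps] s' (M * (?T + 3) + 1) (K s')"
    if s': "s' \<in> set_pmf (map_pmf ?S orc)" for s'
  proof -
    obtain z where z: "s' = ?S z" using s' by auto
    have b: "length b = n" if "b \<in> set (refine z bs)" for b
      using that set_refine Suc.prems(2) by blast
    have c: "chunks n (concat (refine z bs)) = refine z bs"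
      using n b by (rule chunks_concat)
    show ?thesis
      using Suc.prems b length_refine[of z bs] unfolding z K_def
      by (intro computes_weaken[OF Suc.IH[of _ "refine z bs"]]) (auto simp: c fun_eq_iff intro!: map_pmf_cong)
  qed
  have c: "chunks n (concat (refine z bs)) = refine z bs" for z
    using n set_refine Suc.prems(2) by (intro chunks_concat) blast+
  have "K (?S z) =
      map_pmf (\<lambda>zs. s(0 := concat (fold refine (z # zs) bs), 10 := [])) (replicate_pmf M orc)" for z
    unfolding K_def by (intro map_pmf_cong) (auto simp: c fun_eq_iff)
  then have K: "bind_pmf (map_pmf ?S orc) K =
      map_pmf (\<lambda>zs. s(0 := concat (fold refine zs bs), 10 := [])) (replicate_pmf (Suc M) orc)"
    by (simp add: bind_map_pmf map_bind_pmf) (simp add: map_pmf_def)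
  have "holds (Nonempty 10) s" using Suc.prems by simp
  from computes_Loop_bind[OF this 1 2] show ?case
    unfolding K by (rule computes_weaken) (simp_all add: algebra_simps fun_upd_def)
qed

lemma computes_learner:
  fixes s :: stacks
  assumes n: "0 < n" and orc: "\<And>z. z \<in> set_pmf orc \<Longrightarrow> length z = Suc n"
    and bs: "\<And>b. b \<in> set bs \<Longrightarrow> length b = n"
    and s: "s 0 = unary n" "s 1 = unary e" "s 2 = unary d" "s 4 = concat bs" "\<And>r. 4 < r \<Longrightarrow> s r = []"
  defines "l \<equiv> length (concat bs)"
  obtains D where "computes orc learner s (100 * (n + l + e + d + 1) ^ 5) D"
    and "map_pmf (\<lambda>s. s 0) D =
      map_pmf (\<lambda>zs. concat (fold refine zs bs)) (replicate_pmf (d * (e * l)) orc)"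
proof -
  let ?c = "concat bs" and ?k = "e * l" and ?M = "d * (e * l)"
  let ?s1 = "s(0 := [])"
  let ?s2 = "?s1(4 := [], 9 := rev ?c)"
  let ?s3 = "?s2(1 := [], 5 := replicate ?k True)"
  let ?s4 = "?s3(2 := [], 10 := replicate ?M True)"
  let ?s5 = "?s4(5 := [])"
  let ?s6 = "?s5(9 := [], 0 := ?c)"
  let ?D = "map_pmf (\<lambda>zs. ?s6(0 := concat (fold refine zs bs), 10 := [])) (replicate_pmf ?M orc)"
  \<comment> \<open>As \<open>n\<close> is positive, the number of blocks is at most the number of
    bits, so \<open>l\<close> can act as the bound \<open>B\<close>.\<close>
  have "length bs * n = l"
    unfolding l_def using bs by (simp add: length_concat_blocks)
  then have B: "length bs \<le> l" using n by (cases n) auto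
  have p1: "computes orc [clear 0] s (2 * n + 1) (return_pmf ?s1)"
    using s by (intro computes_weaken[OF computes_clear]) (auto simp: unary_def)
  \<comment> \<open>Parking the description on stack 9 frees stack 4 as scratch for the
    multiplication; the later move to stack 0 undoes the reversal.\<close>
  have p2: "computes orc [move 4 9] ?s1 (4 * l + 1) (return_pmf ?s2)"
    using s by (intro computes_weaken[OF computes_move]) (auto simp: l_def fun_eq_iff)
  have p3: "computes orc [multiply 1 9 4 5] ?s2 (e * (9 * l + 4) + 1) (return_pmf ?s3)"
    using s by (intro computes_weaken[OF computes_multiply]) (auto simp: l_def unary_def fun_eq_iff)
  have p4: "computes orc [multiply 2 5 6 10] ?s3 (d * (9 * ?k + 4) + 1) (return_pmf ?s4)"
    using s by (intro computes_weaken[OF computes_multiply]) (auto simp: unary_def fun_eq_iff)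
  have p5: "computes orc [clear 5] ?s4 (2 * ?k + 1) (return_pmf ?s5)"
    by (intro computes_weaken[OF computes_clear]) (auto simp: fun_eq_iff)
  have p6: "computes orc [move 9 0] ?s5 (4 * l + 1) (return_pmf ?s6)"
    by (intro computes_weaken[OF computes_move]) (auto simp: l_def fun_eq_iff)
  have p7: "computes orc [Loop (Nonempty 10) (Pop 10 # Query 1 # process)] ?s6
      (?M * (40 * ((n + 1) * (l + 1)) + 3) + 1) ?D"
    using s bs orc n B by (intro computes_samples) (auto simp: unary_def)
  let ?N = "n + l + e + d + 1"
  have bound: "x \<le> ?N ^ 5" if "x \<le> ?N ^ i" "i \<le> 5" for x i
    using that power_increasing[of i 5 ?N] by linarith
  have "n \<le> ?N ^ 5" "l \<le> ?N ^ 5" "e \<le> ?N ^ 5" "d \<le> ?N ^ 5" "1 \<le> ?N ^ 5"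
    by (rule bound[of _ 1]; simp)+
  moreover have "e * l \<le> ?N ^ 5"
  proof (rule bound[of _ 2])
    show "e * l \<le> ?N ^ 2" unfolding power2_eq_square by (intro mult_le_mono) auto
  qed simp
  \<comment> \<open>The exponent 5 arises here: degree three for the number of examples, degree two
    for the work on each.\<close>
  moreover have M: "?M \<le> ?N ^ 3"
    unfolding power3_eq_cube mult.assoc by (intro mult_le_mono) auto
  then have "?M \<le> ?N ^ 5" by (rule bound) simp
  moreover have "?M * ((n + 1) * (l + 1)) \<le> ?N ^ 5"
  proof -
    have "(n + 1) * (l + 1) \<le> ?N ^ 2"
      unfolding power2_eq_square by (intro mult_le_mono) auto
    from mult_le_mono[OF M this] show ?thesis by (simp flip: power_add)
  qed
  ultimately have "2 * n + 1 + (4 * l + 1 + (e * (9 * l + 4) + 1 + (d * (9 * ?k + 4) + 1 +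
      (2 * ?k + 1 + (4 * l + 1 + (?M * (40 * ((n + 1) * (l + 1)) + 3) + 1))))))
      \<le> 100 * ?N ^ 5" (is "?T \<le> _")
    \<comment> \<open>With the numerals pulled to the front, the claim is linear in the products
      estimated above. The coefficients, constants included, sum to 88.\<close>
    unfolding distrib_left mult.left_commute[of e 9] mult.left_commute[of d 9]
      mult.left_commute[of ?M 40] by linarith
  moreover have "computes orc learner s ?T ?D"
    using computes_Cons[OF p1 computes_Cons[OF p2 computes_Cons[OF p3 computes_Cons[OF p4
      computes_Cons[OF p5 computes_Cons[OF p6 p7]]]]]] unfolding learner_def .
  ultimately have "computes orc learner s (100 * ?N ^ 5) ?D"
    by (blast intro: computes_weaken)
  moreover have "map_pmf (\<lambda>s. s 0) ?D =
      map_pmf (\<lambda>zs. concat (fold refine zs bs)) (replicate_pmf ?M orc)"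
    by (simp add: pmf.map_comp o_def)
  ultimately show ?thesis by (rule that)
qed


section \<open>Sample complexity of elimination\<close>

text \<open>Integrating over the first sample gives one factor per step; nonnegative integrals avoid
  integrability conditions.\<close>

lemma emeasure_replicate_pmf_subset:
  "emeasure (replicate_pmf M \<rho>) {zs. set zs \<subseteq> A} = emeasure \<rho> A ^ M"
proof (induction M)
  case 0
  then show ?case by (simp add: emeasure_return_pmf)
next
  case (Suc M)
  have "emeasure (replicate_pmf (Suc M) \<rho>) {zs. set zs \<subseteq> A} =
      (\<integral>\<^sup>+x. emeasure (replicate_pmf M \<rho>) ((#) x -` {zs. set zs \<subseteq> A}) \<partial>\<rho>)"
    by (simp add: map_pmf_def[symmetric])
  also have "\<dots> = (\<integral>\<^sup>+x. emeasure \<rho> A ^ M * indicator A x \<partial>\<rho>)"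
    by (intro nn_integral_cong) (auto simp: vimage_def Suc.IH indicator_def)
  also have "\<dots> = emeasure \<rho> A ^ Suc M"
    by (subst nn_integral_cmult_indicator) (simp_all add: mult.commute)
  finally show ?case .
qed

lemma prob_replicate_pmf_subset:
  "measure_pmf.prob (replicate_pmf M \<rho>) {zs. set zs \<subseteq> A} = measure_pmf.prob \<rho> A ^ M"
  using emeasure_replicate_pmf_subset[of M \<rho> A]
  by (simp add: measure_pmf.emeasure_eq_measure ennreal_power)

text \<open>Bernoulli's inequality gives \<open>M * p \<le> (1 + p) ^ M\<close>, and
  \<open>(1 + p) * (1 - p) \<le> 1\<close>.\<close>

lemma mult_power_complement_le:
  fixes p :: real
  assumes "0 \<le> p" "p \<le> 1"
  shows "real M * (p * (1 - p) ^ M) \<le> 1"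
proof -
  have "real M * (p * (1 - p) ^ M) \<le> (1 + real M * p) * (1 - p) ^ M"
    using assms by (simp add: algebra_simps)
  also have "\<dots> \<le> (1 + p) ^ M * (1 - p) ^ M"
    using assms Bernoulli_inequality[of p M] by (intro mult_right_mono) auto
  also have "\<dots> = (1 - p\<^sup>2) ^ M"
    by (simp add: power_mult_distrib[symmetric] power2_eq_square algebra_simps)
  also have "\<dots> \<le> 1"
    using assms by (intro power_le_one) (auto simp: power_le_one)
  finally show ?thesis .
qed

lemma elimination_PAC:
  fixes \<rho> :: "'a pmf" and t :: "'i \<Rightarrow> 'a \<Rightarrow> bool"
  assumes I: "finite I" "J \<subseteq> I" and f: "\<And>x. f x \<longleftrightarrow> (\<forall>i\<in>J. t i x)"
    and pos: "0 < \<epsilon>" "0 < \<delta>" and M: "real (card I) \<le> real M * \<epsilon> * \<delta>"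
  shows "1 - \<delta> \<le> measure_pmf.prob (replicate_pmf M \<rho>)
    {zs. measure_pmf.prob \<rho>
       {x. (\<forall>i\<in>I. (\<forall>z\<in>set zs. f z \<longrightarrow> t i z) \<longrightarrow> t i x) \<noteq> f x} \<le> \<epsilon>}"
proof -
  define R where "R = replicate_pmf M \<rho>"
  define S where "S i = {zs. \<forall>z\<in>set zs. f z \<longrightarrow> t i z}" for i
  define p where "p i = measure_pmf.prob \<rho> {x. f x \<and> \<not> t i x}" for i
  define err where
    "err zs = measure_pmf.prob \<rho> {x. (\<forall>i\<in>I. zs \<in> S i \<longrightarrow> t i x) \<noteq> f x}" for zs
  \<comment> \<open>A union bound majorant of the error. It is linear in the survival indicators, so
    its expectation needs only the survival probability of each single feature.\<close>
  define X where "X zs = (\<Sum>i\<in>I. p i * indicator (S i) zs)" for zs :: "'a list"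
  have p: "0 \<le> p i" "p i \<le> 1" for i by (auto simp: p_def)
  have err: "err zs \<le> X zs" for zs
  proof -
    have "err zs \<le> measure_pmf.prob \<rho> (\<Union>i\<in>{i\<in>I. zs \<in> S i}. {x. f x \<and> \<not> t i x})"
      unfolding err_def
    proof (rule measure_pmf.finite_measure_mono)
      \<comment> \<open>Features of the target are never falsified by a positive example. Hence the
        hypothesis implies the target, and errors are one-sided.\<close>
      have "zs \<in> S i" if "i \<in> J" for i
        using that f by (auto simp: S_def)
      then have "\<exists>i\<in>I. zs \<in> S i \<and> f x \<and> \<not> t i x"
        if "(\<forall>i\<in>I. zs \<in> S i \<longrightarrow> t i x) \<noteq> f x" for x
        using that I(2) f[of x] by (metis subsetD)
      then show "{x. (\<forall>i\<in>I. zs \<in> S i \<longrightarrow> t i x) \<noteq> f x} \<subseteq>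
          (\<Union>i\<in>{i\<in>I. zs \<in> S i}. {x. f x \<and> \<not> t i x})"
        by auto
    qed simp
    also have "\<dots> \<le> (\<Sum>i\<in>{i\<in>I. zs \<in> S i}. p i)"
      unfolding p_def using I(1) by (intro measure_pmf.finite_measure_subadditive_finite) auto
    also have "\<dots> = X zs"
      unfolding X_def using I(1)
      by (simp add: indicator_def if_distrib[of "\<lambda>a. _ * a"] sum.If_cases Int_def cong: if_cong)
    finally show ?thesis .
  qed
  \<comment> \<open>Survival means that all samples avoid the event of probability
    \<open>p i\<close>.\<close>
  have S: "measure_pmf.prob R (S i) = (1 - p i) ^ M" for i
  proof -
    have "measure_pmf.prob R (S i) = measure_pmf.prob \<rho> (- {x. f x \<and> \<not> t i x}) ^ M"
      unfolding R_def by (subst prob_replicate_pmf_subset[symmetric])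
        (auto simp: S_def intro!: arg_cong[of _ _ "measure _"])
    then show ?thesis
      by (simp add: p_def measure_pmf.prob_compl[of _ \<rho>, simplified] Compl_eq_Diff_UNIV)
  qed
  have X: "0 \<le> X zs" for zs
    unfolding X_def by (intro sum_nonneg mult_nonneg_nonneg p) auto
  have ind: "integrable R (indicator (S i) :: _ \<Rightarrow> real)" for i
    by (rule measure_pmf.integrable_const_bound[where B = 1]) auto
  have int: "integrable R X"
    unfolding X_def by (intro Bochner_Integration.integrable_sum integrable_mult_right ind)
  have "real M * measure_pmf.expectation R X = (\<Sum>i\<in>I. real M * (p i * (1 - p i) ^ M))"
    unfolding X_def by (subst Bochner_Integration.integral_sum) (auto simp: S sum_distrib_left ind)
  also have "\<dots> \<le> real (card I)"
    using sum_mono[of I "\<lambda>i. real M * (p i * (1 - p i) ^ M)" "\<lambda>_. 1"]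
      mult_power_complement_le p by simp
  finally have E: "real M * measure_pmf.expectation R X \<le> real (card I)" .
  have "measure_pmf.expectation R X \<le> \<epsilon> * \<delta>"
  \<comment> \<open>Without samples one cannot divide by \<open>M\<close>, but then the bound on
    \<open>card I\<close> leaves no features at all.\<close>
  proof (cases "M = 0")
    case True
    then have "I = {}" using M I(1) by simp
    then show ?thesis using pos unfolding X_def by simp
  next
    case False
    have "real M * measure_pmf.expectation R X \<le> real M * (\<epsilon> * \<delta>)"
      using E M by (simp add: mult.assoc)
    then show ?thesis using False by simp
  qed
  moreover have "measure_pmf.prob R {zs. \<epsilon> \<le> X zs} \<le> measure_pmf.expectation R X / \<epsilon>"
    using integral_Markov_inequality_measure[OF int, of UNIV \<epsilon>] pos X by simp
  ultimately have "measure_pmf.prob R {zs. \<epsilon> \<le> X zs} \<le> \<delta>"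
    using pos by (smt (verit) divide_le_eq mult.commute)
  moreover have "measure_pmf.prob R (- {zs. err zs \<le> \<epsilon>}) \<le> measure_pmf.prob R {zs. \<epsilon> \<le> X zs}"
  proof (intro measure_pmf.finite_measure_mono subsetI CollectI)
    fix zs assume "zs \<in> - {zs. err zs \<le> \<epsilon>}"
    then show "\<epsilon> \<le> X zs" using err[of zs] by simp
  qed simp
  ultimately have "1 - \<delta> \<le> measure_pmf.prob R {zs. err zs \<le> \<epsilon>}"
    using measure_pmf.prob_compl[of "{zs. err zs \<le> \<epsilon>}" R] by (simp add: Compl_eq_Diff_UNIV)
  then show ?thesis
    by (simp add: R_def err_def S_def)
qed


section \<open>The learning theorem\<close>

definition incidence :: "nat \<Rightarrow> nat set \<Rightarrow> bool list" where
  "incidence n T = map (\<lambda>i. i \<in> T) [0..<n]"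

lemma length_incidence [simp]: "length (incidence n T) = n"
  by (simp add: incidence_def)

lemma meets_incidence:
  assumes "length x = n" and "T \<subseteq> {..<n}"
  shows "meets x (incidence n T) \<longleftrightarrow> (\<exists>i\<in>T. x ! i)"
  using assms by (simp add: meets_iff incidence_def cong: conj_cong) blast

text \<open>Connects words with abstract elimination: all survivors have length \<open>n\<close>, so
  decoding recovers them, and \<open>set_fold_refine\<close> says which they are.\<close>

lemma hyp_fold_refine:
  assumes n: "0 < n" and Ts: "\<And>T. T \<in> set Ts \<Longrightarrow> T \<subseteq> {..<n}"
    and zs: "\<And>z. z \<in> set zs \<Longrightarrow> length z = n" and x: "length x = n"
  shows "hyp (concat (fold refine (map (\<lambda>z. z @ [f z]) zs) (map (incidence n) Ts))) x \<longleftrightarrow>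
    (\<forall>T\<in>set Ts. (\<forall>z\<in>set zs. f z \<longrightarrow> (\<exists>i\<in>T. z ! i)) \<longrightarrow> (\<exists>i\<in>T. x ! i))"
proof -
  let ?bs = "fold refine (map (\<lambda>z. z @ [f z]) zs) (map (incidence n) Ts)"
  have set: "set ?bs = {b \<in> incidence n ` set Ts. \<forall>z\<in>set zs. f z \<longrightarrow> meets z b}"
    by (simp add: set_fold_refine)
  have "chunks (length x) (concat ?bs) = ?bs"
    using n x set by (intro chunks_concat) auto
  then have "hyp (concat ?bs) x \<longleftrightarrow> (\<forall>b\<in>set ?bs. meets x b)"
    by (simp add: hyp_def)
  also have "\<dots> \<longleftrightarrow>
      (\<forall>T\<in>set Ts. (\<forall>z\<in>set zs. f z \<longrightarrow> meets z (incidence n T)) \<longrightarrow> meets x (incidence n T))"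
    unfolding set by auto
  also have "\<dots> \<longleftrightarrow>
      (\<forall>T\<in>set Ts. (\<forall>z\<in>set zs. f z \<longrightarrow> (\<exists>i\<in>T. z ! i)) \<longrightarrow> (\<exists>i\<in>T. x ! i))"
    using Ts zs x by (simp add: meets_incidence)
  finally show ?thesis .
qed

lemma replicate_map_pmf: "replicate_pmf M (map_pmf g p) = map_pmf (map g) (replicate_pmf M p)"
  by (induction M) (simp_all add: bind_map_pmf map_bind_pmf)

lemma learned_hyp_accurate:
  assumes n: "0 < n" and Ts: "\<And>T. T \<in> set Ts \<Longrightarrow> T \<subseteq> {..<n}" and F: "set F \<subseteq> set Ts"
    and \<rho>: "set_pmf \<rho> \<subseteq> cube n" and pos: "0 < \<epsilon>" "0 < \<delta>"
    and M: "real (length Ts) \<le> real M * \<epsilon> * \<delta>"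
  shows "1 - \<delta> \<le> measure_pmf.prob
    (map_pmf (\<lambda>zs. concat (fold refine zs (map (incidence n) Ts)))
      (replicate_pmf M (example_oracle (eval_formula F) \<rho>)))
    {w. measure_pmf.prob \<rho> {x. hyp w x \<noteq> eval_formula F x} \<le> \<epsilon>}"
proof -
  let ?f = "eval_formula F" and ?t = "\<lambda>T x. \<exists>i\<in>T. x ! i"
  let ?h = "\<lambda>zs. concat (fold refine (map (\<lambda>z. z @ [?f z]) zs) (map (incidence n) Ts))"
  let ?h' = "\<lambda>zs x. \<forall>T\<in>set Ts. (\<forall>z\<in>set zs. ?f z \<longrightarrow> ?t T z) \<longrightarrow> ?t T x"
  let ?R = "replicate_pmf M \<rho>"
  \<comment> \<open>The two hypotheses are compared only on words of length \<open>n\<close>, so the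
    events agree almost surely and not necessarily as sets.\<close>
  have eq: "measure_pmf.prob \<rho> {x. hyp (?h zs) x \<noteq> ?f x} = measure_pmf.prob \<rho> {x. ?h' zs x \<noteq> ?f x}"
    if zs: "zs \<in> set_pmf ?R" for zs
  proof -
    have z: "length z = n" if "z \<in> set zs" for z
      using zs that \<rho> by (auto simp: set_replicate_pmf cube_def)
    have "hyp (?h zs) x \<longleftrightarrow> ?h' zs x" if "x \<in> set_pmf \<rho>" for x
      using that \<rho> by (intro hyp_fold_refine[OF n Ts z]) (auto simp: cube_def)
    then show ?thesis
      by (intro measure_pmf.finite_measure_eq_AE) (simp_all add: AE_measure_pmf_iff)
  qed
  have "real (card (set Ts)) \<le> real M * \<epsilon> * \<delta>"
    using M card_length[of Ts] by linarith
  then have "1 - \<delta> \<le> measure_pmf.prob ?R {zs. measure_pmf.prob \<rho> {x. ?h' zs x \<noteq> ?f x} \<le> \<epsilon>}"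
    using F pos by (intro elimination_PAC[where J = "set F"]) (auto simp: eval_formula_def)
  also have "\<dots> = measure_pmf.prob ?R {zs. measure_pmf.prob \<rho> {x. hyp (?h zs) x \<noteq> ?f x} \<le> \<epsilon>}"
    using eq by (intro measure_pmf.finite_measure_eq_AE) (simp_all add: AE_measure_pmf_iff)
  finally show ?thesis
    by (simp add: example_oracle_def replicate_map_pmf pmf.map_comp o_def vimage_def)
qed

section \<open>Rounded parameters and the polynomial time bound\<close>

lemma unary_inverse_le:
  assumes "0 < \<epsilon>"
  shows "real (nat \<lceil>1 / \<epsilon>\<rceil>) \<le> 1 / \<epsilon> + 1"
proof -
  have "0 < 1 / \<epsilon>" using assms by simp
  then show ?thesis using of_int_ceiling_le_add_one[of "1 / \<epsilon>"] by linarith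
qed

lemma one_le_unary_inverse:
  assumes "0 < \<epsilon>"
  shows "1 \<le> real (nat \<lceil>1 / \<epsilon>\<rceil>) * \<epsilon>"
proof -
  have "1 = 1 / \<epsilon> * \<epsilon>" using assms by simp
  also have "\<dots> \<le> real (nat \<lceil>1 / \<epsilon>\<rceil>) * \<epsilon>"
    using real_nat_ceiling_ge assms by (intro mult_right_mono) auto
  finally show ?thesis .
qed

lemma learner_time_bound:
  assumes n: "0 < n" and l: "l \<le> c * n ^ k" and pos: "0 < \<epsilon>" "0 < \<delta>" "0 < \<eta>"
  shows "100 * (n + l + nat \<lceil>1 / \<epsilon>\<rceil> + nat \<lceil>1 / \<delta>\<rceil> + 1) ^ 5
    \<le> learner_time (100 * (c + 4) ^ 5) (5 * Suc k) n \<epsilon> \<delta> \<eta>"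
proof -
  define B where "B = real n + 1 / \<epsilon> + 1 / \<delta> + 1 / \<eta>"
  let ?N = "n + l + nat \<lceil>1 / \<epsilon>\<rceil> + nat \<lceil>1 / \<delta>\<rceil> + 1"
  have "1 / \<epsilon> > 0" "1 / \<delta> > 0" "1 / \<eta> > 0" using pos by auto
  then have B: "1 \<le> B" "real n \<le> B" "real n + 1 / \<epsilon> + 1 / \<delta> \<le> B"
    using n unfolding B_def by linarith+
  have "real l \<le> real (c * n ^ k)" using l by (simp only: of_nat_le_iff)
  also have "\<dots> = real c * real n ^ k" by simp
  also have "\<dots> \<le> real c * B ^ Suc k"
    using B by (intro mult_left_mono order_trans[OF power_mono power_increasing]) auto
  finally have "real l \<le> real c * B ^ Suc k" .
  moreover have "B \<le> B ^ Suc k" using B by (simp add: self_le_power)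
  \<comment> \<open>The 4 covers the real parameters, two roundings and the final 1, each at most
    \<open>B\<close> because \<open>B \<ge> 1\<close>.\<close>
  ultimately have "real ?N \<le> (real c + 4) * B ^ Suc k"
    using unary_inverse_le[OF pos(1)] unary_inverse_le[OF pos(2)] B
    by (simp only: of_nat_add of_nat_1 distrib_right)
  then have "real ?N ^ 5 \<le> ((real c + 4) * B ^ Suc k) ^ 5"
    by (intro power_mono) auto
  also have "\<dots> = (real c + 4) ^ 5 * B ^ (5 * Suc k)"
    by (simp only: power_mult_distrib power_mult[symmetric] mult.commute)
  finally have "real (100 * ?N ^ 5) \<le> real (100 * (c + 4) ^ 5) * B ^ (5 * Suc k)"
    by simp
  then show ?thesis
    unfolding learner_time_def B_def by (simp only: le_nat_floor)
qed

lemma set_select: "set (select Ts \<theta>) \<subseteq> set Ts"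
  by (auto simp: select_def dest: set_zip_rightD)

theorem theorem1p7:
  fixes m :: "nat \<Rightarrow> nat"
    and L :: "nat \<Rightarrow> nat set list"
    and \<mu> :: "nat \<Rightarrow> bool list pmf"
  assumes "poly_bounded m"
    and "\<And>n. n > 0 \<Longrightarrow> length (L n) = m n"
    and "\<And>n T. n > 0 \<Longrightarrow> T \<in> set (L n) \<Longrightarrow> T \<subseteq> {..<n}"
    and "\<And>n. n > 0 \<Longrightarrow> set_pmf (\<mu> n) \<subseteq> cube (m n)"
    and "poly_time_samplable (describe L) \<mu>"
  shows "efficiently_dist_PAC_learnable DNF eval_formula (mu_and_or L \<mu>) (describe L)"
proof -
  obtain c k where ck: "\<And>n. n > 0 \<Longrightarrow> m n \<le> c * n ^ k"
    using assms(1) unfolding poly_bounded_def by blast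
  \<comment> \<open>The description has \<open>m n * n\<close> bits, hence one more power of
    \<open>n\<close> than the list length.\<close>
  let ?c = "100 * (c + 4) ^ 5" and ?k = "5 * Suc (Suc k)"
  have sub: "set F \<subseteq> set (L n)" if "F \<in> set_pmf (mu_and_or L \<mu> n)" for F n
    using that set_select by (fastforce simp: mu_and_or_def)
  have dnf: "set_pmf (mu_and_or L \<mu> n) \<subseteq> DNF n" if "n > 0" for n
    using sub assms(3)[OF that] by (fastforce simp: DNF_def)
  have main: "(\<forall>f \<rho>. set_pmf \<rho> \<subseteq> cube n \<longrightarrow> halts_within (example_oracle f \<rho>) learner inp t) \<and>
      1 - \<eta> \<le> measure_pmf.prob (mu_and_or L \<mu> n)
        {F. \<forall>\<rho>. set_pmf \<rho> \<subseteq> cube n \<longrightarrow>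
          1 - \<delta> \<le> measure_pmf.prob (final_output (example_oracle (eval_formula F) \<rho>) learner inp t)
            {w. measure_pmf.prob \<rho> {x. hyp w x \<noteq> eval_formula F x} \<le> \<epsilon>}}"
    if n: "n > 0" and pos: "\<epsilon> > 0" "\<delta> > 0" "\<eta> > 0"
      and inp: "inp = learner_input n \<epsilon> \<delta> \<eta> (describe L n)" and t: "t = learner_time ?c ?k n \<epsilon> \<delta> \<eta>"
    for n \<epsilon> \<delta> \<eta> inp t
  proof -
    let ?e = "nat \<lceil>1 / \<epsilon>\<rceil>" and ?d = "nat \<lceil>1 / \<delta>\<rceil>"
    define bs where "bs = map (incidence n) (L n)"
    define l where "l = length (concat bs)"
    define s where "s = (\<lambda>r. if r < length inp then inp ! r else [])"
    have desc: "describe L n = concat bs"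
      by (simp add: describe_def bs_def incidence_def[abs_def])
    have l: "l = length (L n) * n"
      unfolding l_def bs_def by (subst length_concat_blocks[of _ n]) auto
    have "l \<le> c * n ^ Suc k"
      using mult_right_mono[OF ck[OF n], of n] assms(2)[OF n] by (simp add: l mult_ac)
    then have time: "100 * (n + l + ?e + ?d + 1) ^ 5 \<le> t"
      unfolding t using n pos by (intro learner_time_bound) auto
    have s: "s 0 = unary n" "s 1 = unary ?e" "s 2 = unary ?d" "s 4 = concat bs"
      "\<And>r. 4 < r \<Longrightarrow> s r = []"
      by (simp_all add: s_def inp learner_input_def desc eval_nat_numeral)
    have b: "length b = n" if "b \<in> set bs" for b
      using that by (auto simp: bs_def)
    \<comment> \<open>Only the length of the samples matters here, so halting follows for arbitrary
      labellings.\<close>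
    have run: "halts_within orc learner inp t \<and> final_output orc learner inp t =
        map_pmf (\<lambda>zs. concat (fold refine zs bs)) (replicate_pmf (?d * (?e * l)) orc)"
      if orc: "\<And>z. z \<in> set_pmf orc \<Longrightarrow> length z = Suc n" for orc
    proof -
      obtain D where "computes orc learner s (100 * (n + l + ?e + ?d + 1) ^ 5) D"
        and D: "map_pmf (\<lambda>s. s 0) D =
          map_pmf (\<lambda>zs. concat (fold refine zs bs)) (replicate_pmf (?d * (?e * l)) orc)"
        unfolding l_def using orc by (rule computes_learner[OF n _ b s])
      from computes_initial[OF this(1)[unfolded s_def] time] D show ?thesis by simp
    qed
    have orc: "length z = Suc n"
      if "set_pmf \<rho> \<subseteq> cube n" "z \<in> set_pmf (example_oracle f \<rho>)" for f \<rho> z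
      using that by (auto simp: example_oracle_def cube_def)
    \<comment> \<open>The learner multiplies by the number of bits instead of the number of
      disjunctions, which only increases the sample.\<close>
    have "real (length (L n)) \<le> real l * 1 * 1"
      using n mult_left_mono[of 1 "real n" "real (length (L n))"] by (simp add: l)
    also have "\<dots> \<le> real l * (real ?e * \<epsilon>) * (real ?d * \<delta>)"
      using one_le_unary_inverse[OF pos(1)] one_le_unary_inverse[OF pos(2)] pos
      by (intro mult_mono mult_nonneg_nonneg of_nat_0_le_iff) (simp_all add: less_imp_le)
    finally have M: "real (length (L n)) \<le> real (?d * (?e * l)) * \<epsilon> * \<delta>"
      by (simp add: mult_ac)
    have "1 - \<delta> \<le> measure_pmf.prob (final_output (example_oracle (eval_formula F) \<rho>) learner inp t)
          {w. measure_pmf.prob \<rho> {x. hyp w x \<noteq> eval_formula F x} \<le> \<epsilon>}"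
      if "F \<in> set_pmf (mu_and_or L \<mu> n)" "set_pmf \<rho> \<subseteq> cube n" for F \<rho>
      using learned_hyp_accurate[OF n assms(3)[OF n] sub[OF that(1)] that(2) pos(1,2) M]
        run[OF orc[OF that(2)]] by (simp add: bs_def)
    \<comment> \<open>Learning succeeds for every formula in the support, so the outer probability
      is 1.\<close>
    then have "measure_pmf.prob (mu_and_or L \<mu> n)
        {F. \<forall>\<rho>. set_pmf \<rho> \<subseteq> cube n \<longrightarrow>
          1 - \<delta> \<le> measure_pmf.prob (final_output (example_oracle (eval_formula F) \<rho>) learner inp t)
            {w. measure_pmf.prob \<rho> {x. hyp w x \<noteq> eval_formula F x} \<le> \<epsilon>}} = 1"
      by (subst measure_pmf.prob_eq_1) (auto simp: AE_measure_pmf_iff)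
    then show ?thesis using run orc pos by auto
  qed
  show ?thesis
    unfolding efficiently_dist_PAC_learnable_def Let_def
  proof (rule conjI, use dnf in simp, rule exI[of _ learner], rule exI[of _ hyp],
      rule exI[of _ ?c], rule exI[of _ ?k], rule conjI[OF poly_time_evaluable_hyp], intro allI impI)
    fix n :: nat and \<epsilon> \<delta> \<eta> :: real
    assume "n > 0" "\<epsilon> > 0" "\<delta> > 0" "\<eta> > 0"
    from main[OF this refl refl]
    show "(\<forall>f \<rho>. set_pmf \<rho> \<subseteq> cube n \<longrightarrow> halts_within (example_oracle f \<rho>) learner
          (learner_input n \<epsilon> \<delta> \<eta> (describe L n)) (learner_time ?c ?k n \<epsilon> \<delta> \<eta>)) \<and>
        1 - \<eta> \<le> measure_pmf.prob (mu_and_or L \<mu> n) {F. \<forall>\<rho>. set_pmf \<rho> \<subseteq> cube n \<longrightarrow>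
          1 - \<delta> \<le> measure_pmf.prob (final_output (example_oracle (eval_formula F) \<rho>) learner
              (learner_input n \<epsilon> \<delta> \<eta> (describe L n)) (learner_time ?c ?k n \<epsilon> \<delta> \<eta>))
            {w. measure_pmf.prob \<rho> {x. hyp w x \<noteq> eval_formula F x} \<le> \<epsilon>}}" .
  qed
qed

end
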